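(* Let $f$ and $g$ be probability density functions compactly supported on a domain $\Pi_2\subseteq\mathbb{R}$, where $g(x)=f(x-s)$ on $\Pi_2^s=\{x\in\mathbb{R}: x-s\in\Pi_2\}$ and $g$ is zero otherwise. For a given $c>0$, let $\tilde f$ and $\tilde g$ be the new density functions defined by the linear normalization $$\tilde f=\frac{f+c}{\int_{\Pi_2}(f+c)\,dx},\qquad \tilde g=\frac{g+c}{\int_{\Pi_2}(g+c)\,dx}.$$ Then $$W_2^2(\tilde f,\tilde g)=\begin{cases}\mathcal{O}(|s|^2) & \text{if } |s|\le \frac1c+|\mathrm{supp}(f)|,\\ \mathcal{O}(|s|) & \text{otherwise.}\end{cases}$$
   Context: $s\in\mathbb{R}$ is the shift parameter, and $|\cdot|$ applied to a set denotes its Lebesgue measure. $W_2$ is the quadratic Wasserstein distance between probability measures (identified with their densities): $W_2(\mu,\nu)=\left(\inf_T\int|x-T(x)|^2\,d\mu(x)\right)^{1/2}$, the infimum being over all maps $T$ that push $\mu$ forward to $\nu$. Big-O notation is defined as follows: for real-valued functions $\phi$ and $\psi$ with domain $\mathbb{R}$, $\phi(x)=\mathcal{O}(\psi(x))$ if there are positive constants $M$ and $k$ such that $|\phi(x)|\le M|\psi(x)|$ for all $x\ge k$; the values of $M$ and $k$ must be fixed for the function $\phi$ and must not depend on $x$. *)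

theory Defs
  imports "HOL-Probability.Probability"
begin

definition supp :: "(real \<Rightarrow> real) \<Rightarrow> real set" where
  "supp f = closure {x. f x \<noteq> 0}"

text \<open>Functions on a domain \<open>D\<close> are represented by their extension by zero to the whole line;
  the condition \<open>supp f \<subseteq> D\<close> makes this harmless.\<close>

definition compactly_supported_pdf :: "real set \<Rightarrow> (real \<Rightarrow> real) \<Rightarrow> bool" where
  "compactly_supported_pdf D f \<longleftrightarrow>
     f \<in> borel_measurable borel \<and> (\<forall>x. 0 \<le> f x) \<and> (\<integral>\<^sup>+ x. ennreal (f x) \<partial>lborel) = 1 \<and>
     compact (supp f) \<and> supp f \<subseteq> D"

definition shifted :: "real set \<Rightarrow> real \<Rightarrow> (real \<Rightarrow> real) \<Rightarrow> real \<Rightarrow> real" where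
  "shifted D s f x = (if x - s \<in> D then f (x - s) else 0)"

definition linear_normalization :: "real set \<Rightarrow> real \<Rightarrow> (real \<Rightarrow> real) \<Rightarrow> real \<Rightarrow> real" where
  "linear_normalization D c f x =
     (if x \<in> D then (f x + c) / (LBINT y:D. (f y + c)) else 0)"

text \<open>The transport cost is a nonnegative extended real, so that a divergent cost integral or an
  empty set of transport maps yields \<open>\<infinity>\<close> rather than a default real value.\<close>

definition W2 :: "real measure \<Rightarrow> real measure \<Rightarrow> ennreal" where
  "W2 \<mu> \<nu> =
     (let I = (INF T \<in> {T. T \<in> measurable \<mu> \<nu> \<and> distr \<mu> \<nu> T = \<nu>}.
                 \<integral>\<^sup>+ x. ennreal (\<bar>x - T x\<bar>\<^sup>2) \<partial>\<mu>)
      in if I = \<infinity> then \<infinity> else ennreal (sqrt (enn2real I)))"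

definition W2_pdf :: "(real \<Rightarrow> real) \<Rightarrow> (real \<Rightarrow> real) \<Rightarrow> ennreal" where
  "W2_pdf p q = W2 (density lborel (\<lambda>x. ennreal (p x))) (density lborel (\<lambda>x. ennreal (q x)))"

text \<open>A domain of the real line is an interval (open or not). Its measure has to be finite, since
  otherwise the integral of \<open>f + c\<close> over it diverges for every \<open>c > 0\<close>.\<close>

definition finite_domain :: "real set \<Rightarrow> bool" where
  "finite_domain D \<longleftrightarrow> connected D \<and> D \<in> fmeasurable lborel"

end

theory Submission
  imports Defs
begin

text \<open>Let \<open>F\<close> and \<open>G\<close> be the distribution functions of \<open>f\<close> and \<open>g\<close>, so that \<open>G y = F (y - s)\<close>.
  The normalized densities have the same normalizing constant, and the monotone transport map
  \<open>T\<close> between them is determined by \<open>G (T x) + c T x = F x + c x\<close>. As distribution functions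
  take values in \<open>[0, 1]\<close>, this gives \<open>c \<bar>x - T x\<bar> \<le> 1\<close>; as \<open>F\<close> is monotone, it also gives
  \<open>\<bar>x - T x\<bar> \<le> \<bar>s\<bar>\<close>. The transport cost is therefore at most both \<open>s\<^sup>2\<close> and \<open>\<bar>s\<bar> / c\<close>.\<close>

section \<open>Bounding the cost, and the monotone map on the whole line\<close>

text \<open>Any one transport map bounds the infimum from above, and a uniform bound on its squared
  displacement passes to the integral because \<open>\<mu>\<close> has total mass 1.\<close>

lemma W2_squared_le:
  assumes "prob_space \<mu>" "T \<in> measurable \<mu> \<nu>" "distr \<mu> \<nu> T = \<nu>"
    and K: "\<And>x. \<bar>x - T x\<bar>\<^sup>2 \<le> K"
  shows "(W2 \<mu> \<nu>)\<^sup>2 \<le> ennreal K"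
proof -
  interpret prob_space \<mu> by fact
  define I where "I = (INF T \<in> {T. T \<in> measurable \<mu> \<nu> \<and> distr \<mu> \<nu> T = \<nu>}.
                 \<integral>\<^sup>+ x. ennreal (\<bar>x - T x\<bar>\<^sup>2) \<partial>\<mu>)"
  have "I \<le> (\<integral>\<^sup>+ x. ennreal (\<bar>x - T x\<bar>\<^sup>2) \<partial>\<mu>)"
    unfolding I_def using assms by (intro INF_lower) auto
  also have "\<dots> \<le> (\<integral>\<^sup>+ x. ennreal K \<partial>\<mu>)"
    by (intro nn_integral_mono ennreal_leI K)
  also have "\<dots> = ennreal K" by (simp add: emeasure_space_1)
  finally have le: "I \<le> ennreal K" .
  \<comment> \<open>Finiteness selects the real branch of \<open>W2\<close>, where squaring undoes
    the square root.\<close>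
  then have "I < \<infinity>" by (metis ennreal_less_top infinity_ennreal_def le_less_trans)
  then have "(W2 \<mu> \<nu>)\<^sup>2 = I"
    unfolding W2_def I_def[symmetric] Let_def
    by (simp add: ennreal_power)
  then show ?thesis using le by simp
qed

lemma continuous_increasing_solvable:
  fixes F :: "real \<Rightarrow> real"
  assumes cont: "continuous_on UNIV F" and F: "\<And>x. 0 \<le> F x" "\<And>x. F x \<le> 1" and c: "c > 0"
  shows "\<exists>x. F x + c * x = z"
proof -
  have cont': "continuous_on A (\<lambda>x. F x + c * x)" for A
    by (intro continuous_intros continuous_on_subset[OF cont]) auto
  \<comment> \<open>The bounds 0 and 1 on \<open>F\<close> bracket a solution between these two
    points, so the intermediate value theorem applies.\<close>
  have "F ((z - 1) / c) + c * ((z - 1) / c) \<le> z" "z \<le> F (z / c) + c * (z / c)"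
    using F(2)[of "(z - 1) / c"] F(1)[of "z / c"] c by auto
  moreover have "(z - 1) / c \<le> z / c" using c by (simp add: divide_right_mono)
  ultimately show ?thesis using IVT'[of "\<lambda>x. F x + c * x" _ z] cont' by blast
qed

text \<open>Adding \<open>c * x\<close> makes both functions strictly increasing, continuous and
  onto, so the two equations determine mutually inverse maps. The last property is the form needed
  for distribution functions: the preimage of a closed left half-line under \<open>T\<close> is
  again one, ending at \<open>S y\<close>.\<close>

lemma monotone_transport:
  fixes F G :: "real \<Rightarrow> real"
  assumes F: "continuous_on UNIV F" "mono F" "\<And>x. 0 \<le> F x" "\<And>x. F x \<le> 1"
    and G: "continuous_on UNIV G" "mono G" "\<And>x. 0 \<le> G x" "\<And>x. G x \<le> 1"
    and c: "c > 0"
  obtains T S where "mono T" "\<And>x. G (T x) + c * T x = F x + c * x"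
    "\<And>y. F (S y) + c * S y = G y + c * y" "\<And>x y. T x \<le> y \<longleftrightarrow> x \<le> S y"
proof -
  obtain T where T: "\<And>x. G (T x) + c * T x = F x + c * x"
    using choice[OF allI[OF continuous_increasing_solvable[OF G(1,3,4) c]], of "\<lambda>x. F x + c * x"]
    by blast
  obtain S where S: "\<And>y. F (S y) + c * S y = G y + c * y"
    using choice[OF allI[OF continuous_increasing_solvable[OF F(1,3,4) c]], of "\<lambda>x. G x + c * x"]
    by blast
  have le_iff: "E x + c * x \<le> E y + c * y \<longleftrightarrow> x \<le> y" if "mono E" for E :: "real \<Rightarrow> real" and x y
  proof -
    have "E x + c * x < E y + c * y" if "x < y" for x y
      using c that monoD[OF \<open>mono E\<close>, of x y] by (intro add_le_less_mono) auto
    moreover have "E x + c * x \<le> E y + c * y" if "x \<le> y" for x y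
      using c that monoD[OF \<open>mono E\<close>, of x y] by (intro add_mono) auto
    ultimately show ?thesis by (metis not_le)
  qed
  have "T x \<le> y \<longleftrightarrow> x \<le> S y" for x y
    using le_iff[OF G(2), of "T x" y] le_iff[OF F(2), of x "S y"] T S by simp
  moreover have "mono T"
  proof (rule monoI)
    fix x y :: real
    assume "x \<le> y"
    then show "T x \<le> T y"
      using le_iff[OF G(2), of "T x" "T y"] le_iff[OF F(2), of x y] T[of x] T[of y] by simp
  qed
  ultimately show ?thesis using that T S by blast
qed

section \<open>Distribution functions of a density and of its normalization\<close>

context
  fixes f :: "real \<Rightarrow> real" and D :: "real set" and c :: real
  assumes f [measurable]: "f \<in> borel_measurable borel" and f_nonneg: "\<And>x. 0 \<le> f x"
    and f_integral: "(\<integral>\<^sup>+ x. ennreal (f x) \<partial>lborel) = 1"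
    and f_zero: "\<And>x. x \<notin> D \<Longrightarrow> f x = 0"
begin

lemma real_distribution_density: "real_distribution (density lborel (\<lambda>x. ennreal (f x)))"
proof -
  have "prob_space (density lborel (\<lambda>x. ennreal (f x)))"
    by (rule prob_spaceI) (simp add: emeasure_density f_integral)
  then show ?thesis
    by (simp add: real_distribution_def real_distribution_axioms_def)
qed

text \<open>Points are Lebesgue null, so a measure with a density has no atoms, and its distribution
  function has no jumps.\<close>

lemma continuous_on_cdf_density:
  "continuous_on UNIV (cdf (density lborel (\<lambda>x. ennreal (f x))))"
proof -
  interpret real_distribution "density lborel (\<lambda>x. ennreal (f x))"
    by (rule real_distribution_density)
  have "emeasure (density lborel (\<lambda>x. ennreal (f x))) {x} = 0" for x
  proof -
    have "{x} \<in> null_sets lborel" by (simp add: null_sets_def)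
    then have "{x} \<in> null_sets (density lborel (\<lambda>x. ennreal (f x)))"
      by (rule absolutely_continuousI_density[unfolded absolutely_continuous_def, THEN subsetD, rotated])
        simp
    then show ?thesis by (simp add: null_sets_def)
  qed
  then show ?thesis
    by (auto intro!: continuous_at_imp_continuous_on simp: isCont_cdf measure_def)
qed

text \<open>Mass can only come from the domain, since the density vanishes elsewhere. Together with
  its counterpart for the right half-line, this later supplies points of \<open>D\<close> on both
  sides of a segment.\<close>

lemma cdf_density_pos_imp:
  assumes "cdf (density lborel (\<lambda>x. ennreal (f x))) x > 0"
  shows "\<exists>y\<in>D. y \<le> x"
proof (rule ccontr)
  assume "\<not> ?thesis"
  then have zero: "ennreal (f y) * indicator {..x} y = 0" for y
    using f_zero by (cases "y \<in> D") auto
  have "emeasure (density lborel (\<lambda>x. ennreal (f x))) {..x} = 0"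
    by (subst emeasure_density) (simp_all only: zero nn_integral_const, simp_all)
  with assms show False by (simp add: cdf_def measure_def)
qed

lemma cdf_density_less_one_imp:
  assumes "cdf (density lborel (\<lambda>x. ennreal (f x))) x < 1"
  shows "\<exists>y\<in>D. x < y"
proof (rule ccontr)
  assume "\<not> ?thesis"
  then have "emeasure (density lborel (\<lambda>x. ennreal (f x))) {..x} = (\<integral>\<^sup>+ y. ennreal (f y) \<partial>lborel)"
    using f_zero
    by (subst emeasure_density) (auto intro!: nn_integral_cong simp: indicator_def not_less)
  with assms show False by (simp add: cdf_def measure_def f_integral)
qed

context
  assumes D: "D \<in> fmeasurable lborel" and c: "c > 0"
begin

text \<open>The value does not involve \<open>f\<close>, because \<open>f\<close> has mass 1 and
  vanishes off \<open>D\<close>. Hence a density and its shift share one normalizing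
  constant.\<close>

lemma set_integral_density_plus_const:
  "(LBINT y:D. (f y + c)) = 1 + c * measure lborel D"
proof -
  have D' [measurable]: "D \<in> sets borel" using D by (simp add: fmeasurable_def)
  have f1: "has_bochner_integral lborel f 1"
    by (rule has_bochner_integral_nn_integral) (use f_nonneg f_integral in auto)
  have c1: "has_bochner_integral lborel (\<lambda>y. indicator D y * c) (measure lborel D * c)"
    using D
    by (intro has_bochner_integral_mult_left has_bochner_integral_real_indicator)
      (auto simp: fmeasurable_def)
  have eq: "indicator D y *\<^sub>R (f y + c) = f y + indicator D y * c" for y
    using f_zero by (auto simp: indicator_def)
  show ?thesis
    using has_bochner_integral_integral_eq[OF has_bochner_integral_add[OF f1 c1]]
    unfolding set_lebesgue_integral_def eq by (simp add: mult.commute)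
qed

lemma emeasure_linear_normalization:
  assumes [measurable]: "A \<in> sets borel"
  shows "emeasure (density lborel (\<lambda>x. ennreal (linear_normalization D c f x))) A =
    ennreal ((measure (density lborel (\<lambda>x. ennreal (f x))) A + c * measure lborel (D \<inter> A))
      / (1 + c * measure lborel D))"
proof -
  interpret real_distribution "density lborel (\<lambda>x. ennreal (f x))"
    by (rule real_distribution_density)
  define Z where "Z = 1 + c * measure lborel D"
  have Z: "Z > 0" unfolding Z_def using c by (simp add: add_pos_nonneg)
  have D' [measurable]: "D \<in> sets borel" using D by (simp add: fmeasurable_def)
  have DA: "D \<inter> A \<in> fmeasurable lborel"
    using D by (intro fmeasurable_Int_fmeasurable) auto
  have eq: "ennreal (linear_normalization D c f x) * indicator A x =
      ennreal (1 / Z) * (ennreal (f x) * indicator A x + ennreal c * indicator (D \<inter> A) x)" for x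
    using f_zero f_nonneg[of x] c Z
    by (auto simp: linear_normalization_def set_integral_density_plus_const Z_def[symmetric]
        indicator_def ennreal_mult[symmetric] ennreal_plus[symmetric] simp del: ennreal_plus)
  have [measurable]: "linear_normalization D c f \<in> borel_measurable borel"
    unfolding linear_normalization_def by measurable
  have "emeasure (density lborel (\<lambda>x. ennreal (linear_normalization D c f x))) A =
      ennreal (1 / Z) * (emeasure (density lborel (\<lambda>x. ennreal (f x))) A
        + ennreal c * emeasure lborel (D \<inter> A))"
    by (simp add: emeasure_density eq nn_integral_cmult nn_integral_add)
  also have "emeasure lborel (D \<inter> A) = ennreal (measure lborel (D \<inter> A))"
    using DA by (simp add: emeasure_eq_measure2)
  finally show ?thesis
    using c Z
    by (simp add: emeasure_eq_measure Z_def[symmetric] ennreal_mult[symmetric] ennreal_plus[symmetric]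
        del: ennreal_plus)
qed

lemma real_distribution_linear_normalization:
  "real_distribution (density lborel (\<lambda>x. ennreal (linear_normalization D c f x)))"
proof -
  interpret real_distribution "density lborel (\<lambda>x. ennreal (f x))"
    by (rule real_distribution_density)
  have "prob_space (density lborel (\<lambda>x. ennreal (linear_normalization D c f x)))"
  proof (rule prob_spaceI)
    have "1 + c * measure lborel D > 0" using c by (simp add: add_pos_nonneg)
    then show "emeasure (density lborel (\<lambda>x. ennreal (linear_normalization D c f x)))
        (space (density lborel (\<lambda>x. ennreal (linear_normalization D c f x)))) = 1"
      using emeasure_linear_normalization[of UNIV] prob_space by simp
  qed
  then show ?thesis
    by (simp add: real_distribution_def real_distribution_axioms_def)
qed

lemma cdf_linear_normalization:
  "cdf (density lborel (\<lambda>x. ennreal (linear_normalization D c f x))) x =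
    (cdf (density lborel (\<lambda>x. ennreal (f x))) x + c * measure lborel (D \<inter> {..x}))
      / (1 + c * measure lborel D)"
  using emeasure_linear_normalization[of "{..x}"] c
  by (simp add: cdf_def measure_def add_nonneg_nonneg)

end

end

section \<open>From the line to the domain, and bounds on the displacement\<close>

lemma measure_Int_atMost_diff:
  fixes x y :: real
  assumes D: "D \<in> fmeasurable lborel" and "x \<le> y" and sub: "{x..y} \<subseteq> D"
  shows "measure lborel (D \<inter> {..y}) = measure lborel (D \<inter> {..x}) + (y - x)"
proof -
  have "D \<inter> {..y} = (D \<inter> {..x}) \<union> {x<..y}"
    using \<open>x \<le> y\<close> sub by auto
  moreover have "D \<inter> {..x} \<in> fmeasurable lborel"
    using D by (intro fmeasurable_Int_fmeasurable) auto
  moreover have "{x<..y} \<in> fmeasurable lborel"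
    using \<open>x \<le> y\<close> by (intro fmeasurableI) auto
  ultimately show ?thesis
    using \<open>x \<le> y\<close>
    by (subst \<open>D \<inter> {..y} = _\<close>, subst measure_Union) (auto simp: fmeasurable_def)
qed

text \<open>If \<open>x \<noteq> y\<close>, then one of the values \<open>F x\<close>, \<open>G y\<close> is less than the other, so that the supports
  reach both below and above the segment between \<open>x\<close> and \<open>y\<close>. Hence the segment lies in \<open>D\<close>, and
  the linear terms may be replaced by the measures of the truncated domain.\<close>

lemma transport_truncated:
  fixes F G :: "real \<Rightarrow> real" and x y :: real
  assumes D: "connected D" "D \<in> fmeasurable lborel" and c: "c > 0"
    and F: "\<And>x. 0 \<le> F x" "\<And>x. F x \<le> 1"
      "\<And>x. 0 < F x \<Longrightarrow> \<exists>y\<in>D. y \<le> x" "\<And>x. F x < 1 \<Longrightarrow> \<exists>y\<in>D. x < y"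
    and G: "\<And>x. 0 \<le> G x" "\<And>x. G x \<le> 1"
      "\<And>x. 0 < G x \<Longrightarrow> \<exists>y\<in>D. y \<le> x" "\<And>x. G x < 1 \<Longrightarrow> \<exists>y\<in>D. x < y"
    and eq: "F x + c * x = G y + c * y"
  shows "F x + c * measure lborel (D \<inter> {..x}) = G y + c * measure lborel (D \<inter> {..y})"
proof -
  \<comment> \<open>By connectedness, one point of \<open>D\<close> on each side of a segment traps
    the segment in \<open>D\<close>.\<close>
  have seg: "{u..v} \<subseteq> D" if "p \<in> D" "p \<le> u" "q \<in> D" "v < q" for p q u v
  proof -
    have "{u..v} \<subseteq> {p..q}" using that by auto
    with connected_contains_Icc[OF D(1) \<open>p \<in> D\<close> \<open>q \<in> D\<close>] show ?thesis by blast
  qed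
  consider "x = y" | "x < y" | "y < x" by linarith
  then show ?thesis
  proof cases
    case 1
    with eq show ?thesis by simp
  next
    case 2
    have "c * x < c * y" using 2 c by simp
    then have "F x > G y" using eq by linarith
    with F(2)[of x] G(1)[of y] have "F x > 0" "G y < 1" by linarith+
    with F(3) G(4) seg have "{x..y} \<subseteq> D" by blast
    with 2 have "measure lborel (D \<inter> {..y}) = measure lborel (D \<inter> {..x}) + (y - x)"
      by (intro measure_Int_atMost_diff[OF D(2)]) auto
    with eq show ?thesis by (simp only: distrib_left right_diff_distrib)
  next
    case 3
    have "c * y < c * x" using 3 c by simp
    then have "F x < G y" using eq by linarith
    with F(1)[of x] G(2)[of y] have "G y > 0" "F x < 1" by linarith+
    with G(3) F(4) seg have "{y..x} \<subseteq> D" by blast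
    with 3 have "measure lborel (D \<inter> {..x}) = measure lborel (D \<inter> {..y}) + (x - y)"
      by (intro measure_Int_atMost_diff[OF D(2)]) auto
    with eq show ?thesis by (simp only: distrib_left right_diff_distrib)
  qed
qed

text \<open>The equation says that \<open>c * (x - y)\<close> is a difference of two values of
  \<open>F\<close>, hence at most 1 in absolute value. Its sign and the monotonicity of
  \<open>F\<close> force \<open>y\<close> to lie between \<open>x\<close> and
  \<open>x + s\<close>.\<close>

lemma transport_displacement:
  fixes F :: "real \<Rightarrow> real"
  assumes F: "mono F" "\<And>x. 0 \<le> F x" "\<And>x. F x \<le> 1" and c: "c > 0"
    and eq: "F (y - s) + c * y = F x + c * x"
  shows "\<bar>x - y\<bar> \<le> \<bar>s\<bar>" "\<bar>x - y\<bar> \<le> 1 / c"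
proof -
  have diff: "c * (x - y) = F (y - s) - F x" using eq by (simp add: algebra_simps)
  have "c * \<bar>x - y\<bar> = \<bar>F (y - s) - F x\<bar>" using c diff by (metis abs_mult abs_of_pos)
  also have "\<dots> \<le> 1" using F(2,3)[of x] F(2,3)[of "y - s"] by linarith
  finally show "\<bar>x - y\<bar> \<le> 1 / c" using c by (simp add: field_simps)
  show "\<bar>x - y\<bar> \<le> \<bar>s\<bar>"
  proof (cases "x \<le> y - s")
    case True
    then have "c * (x - y) \<ge> 0" using diff monoD[OF F(1), of x "y - s"] by simp
    then have "x \<ge> y" using c by (simp add: zero_le_mult_iff)
    with True show ?thesis by linarith
  next
    case False
    then have "c * (x - y) \<le> 0" using diff monoD[OF F(1), of "y - s" x] by simp
    then have "x \<le> y" using c by (simp add: mult_le_0_iff)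
    with False show ?thesis by linarith
  qed
qed

section \<open>The transport bound for normalized densities\<close>

lemma cdf_density_shift:
  fixes f :: "real \<Rightarrow> real"
  assumes [measurable]: "f \<in> borel_measurable borel"
  shows "cdf (density lborel (\<lambda>x. ennreal (f (x - s)))) y =
    cdf (density lborel (\<lambda>x. ennreal (f x))) (y - s)"
proof -
  have "(\<integral>\<^sup>+ x. ennreal (f x) * indicator {..y - s} x \<partial>lborel) =
      (\<integral>\<^sup>+ x. ennreal (f (- s + 1 * x)) * indicator {..y - s} (- s + 1 * x) \<partial>lborel)"
    by (subst nn_integral_real_affine[where c = 1 and t = "- s"]) auto
  also have "\<dots> = (\<integral>\<^sup>+ x. ennreal (f (x - s)) * indicator {..y} x \<partial>lborel)"
    by (intro nn_integral_cong) (auto simp: indicator_def)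
  finally show ?thesis
    by (simp add: cdf_def measure_def emeasure_density)
qed

lemma W2_linear_normalization_le:
  fixes f :: "real \<Rightarrow> real" and c s :: real
  assumes c: "c > 0" and D: "finite_domain D"
    and f: "compactly_supported_pdf D f" and g: "compactly_supported_pdf D (shifted D s f)"
  shows "(W2_pdf (linear_normalization D c f) (linear_normalization D c (shifted D s f)))\<^sup>2
    \<le> ennreal ((min \<bar>s\<bar> (1 / c))\<^sup>2)"
proof -
  define g where "g = shifted D s f"
  have D': "connected D" "D \<in> fmeasurable lborel" using D by (auto simp: finite_domain_def)
  have zero: "h x = 0" if "compactly_supported_pdf D h" "x \<notin> D" for h x
    using that closure_subset[of "{x. h x \<noteq> 0}"]
    by (auto simp: compactly_supported_pdf_def supp_def)
  have fp: "f \<in> borel_measurable borel" "\<And>x. 0 \<le> f x" "(\<integral>\<^sup>+ x. ennreal (f x) \<partial>lborel) = 1"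
      "\<And>x. x \<notin> D \<Longrightarrow> f x = 0"
    using f zero[OF f] by (auto simp: compactly_supported_pdf_def)
  have gp: "g \<in> borel_measurable borel" "\<And>x. 0 \<le> g x" "(\<integral>\<^sup>+ x. ennreal (g x) \<partial>lborel) = 1"
      "\<And>x. x \<notin> D \<Longrightarrow> g x = 0"
    using g zero[OF g] by (auto simp: compactly_supported_pdf_def g_def)
  \<comment> \<open>As \<open>f\<close> vanishes off \<open>D\<close>, the case distinction in
    \<open>shifted\<close> yields the plain translate.\<close>
  have g_eq: "g = (\<lambda>x. f (x - s))" using fp(4) by (auto simp: g_def shifted_def)
  define F where "F = cdf (density lborel (\<lambda>x. ennreal (f x)))"
  define G where "G = cdf (density lborel (\<lambda>x. ennreal (g x)))"
  define \<mu> where "\<mu> = density lborel (\<lambda>x. ennreal (linear_normalization D c f x))"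
  define \<nu> where "\<nu> = density lborel (\<lambda>x. ennreal (linear_normalization D c g x))"
  have G_eq: "G y = F (y - s)" for y
    unfolding F_def G_def g_eq by (rule cdf_density_shift[OF fp(1)])
  interpret f: real_distribution "density lborel (\<lambda>x. ennreal (f x))"
    by (rule real_distribution_density[OF fp])
  interpret g: real_distribution "density lborel (\<lambda>x. ennreal (g x))"
    by (rule real_distribution_density[OF gp])
  interpret \<mu>: real_distribution \<mu>
    unfolding \<mu>_def by (rule real_distribution_linear_normalization[OF fp D'(2) c])
  interpret \<nu>: real_distribution \<nu>
    unfolding \<nu>_def by (rule real_distribution_linear_normalization[OF gp D'(2) c])
  have F: "continuous_on UNIV F" "mono F" "\<And>x. 0 \<le> F x" "\<And>x. F x \<le> 1"
    unfolding F_def using continuous_on_cdf_density[OF fp] f.cdf_nondecreasing f.cdf_nonneg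
      f.cdf_bounded_prob by (auto simp: mono_def)
  have G: "continuous_on UNIV G" "mono G" "\<And>x. 0 \<le> G x" "\<And>x. G x \<le> 1"
    unfolding G_def using continuous_on_cdf_density[OF gp] g.cdf_nondecreasing g.cdf_nonneg
      g.cdf_bounded_prob by (auto simp: mono_def)
  obtain T S where T: "mono T" "\<And>x. G (T x) + c * T x = F x + c * x"
      and S: "\<And>y. F (S y) + c * S y = G y + c * y" and TS: "\<And>x y. T x \<le> y \<longleftrightarrow> x \<le> S y"
    by (rule monotone_transport[OF F G c]) blast
  have [measurable]: "T \<in> borel_measurable borel" by (rule borel_measurable_mono[OF T(1)])
  \<comment> \<open>The equation for \<open>S\<close> has linear terms, whereas the normalized
    distribution functions contain measures of truncated domains. Once these are exchanged, the
    common denominator gives equality.\<close>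
  have cdf_S: "cdf \<mu> (S y) = cdf \<nu> y" for y
  proof -
    have "F (S y) + c * measure lborel (D \<inter> {..S y}) = G y + c * measure lborel (D \<inter> {..y})"
    proof (rule transport_truncated[where F = F and G = G, OF D' c F(3,4) _ _ G(3,4) _ _ S])
      show "\<exists>y\<in>D. y \<le> x" if "0 < F x" for x
        using cdf_density_pos_imp[OF fp] that by (auto simp: F_def)
      show "\<exists>y\<in>D. x < y" if "F x < 1" for x
        using cdf_density_less_one_imp[OF fp] that by (auto simp: F_def)
      show "\<exists>y\<in>D. y \<le> x" if "0 < G x" for x
        using cdf_density_pos_imp[OF gp] that by (auto simp: G_def)
      show "\<exists>y\<in>D. x < y" if "G x < 1" for x
        using cdf_density_less_one_imp[OF gp] that by (auto simp: G_def)
    qed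
    then show ?thesis
      by (simp add: \<mu>_def \<nu>_def F_def G_def cdf_linear_normalization[OF fp D'(2) c]
          cdf_linear_normalization[OF gp D'(2) c])
  qed
  have "distr \<mu> borel T = \<nu>"
  proof (rule cdf_unique)
    show "real_distribution (distr \<mu> borel T)" by (rule \<mu>.real_distribution_distr) simp
    show "cdf (distr \<mu> borel T) = cdf \<nu>"
    proof
      fix y
      \<comment> \<open>This turns \<open>cdf_S\<close> into equality of the distribution functions
        of the image measure and of \<open>\<nu>\<close>, which determine the measures.\<close>
      have "T -` {..y} = {..S y}" using TS by auto
      then show "cdf (distr \<mu> borel T) y = cdf \<nu> y"
        using cdf_S[of y] by (simp add: cdf_def measure_distr)
    qed
  qed (rule \<nu>.real_distribution_axioms)
  moreover have "distr \<mu> \<nu> T = distr \<mu> borel T" by (rule distr_cong) auto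
  moreover have "\<bar>x - T x\<bar>\<^sup>2 \<le> (min \<bar>s\<bar> (1 / c))\<^sup>2" for x
    using transport_displacement[OF F(2,3,4) c, of "T x" s x] T(2)[of x]
    by (intro power_mono) (auto simp: G_eq)
  ultimately have "(W2 \<mu> \<nu>)\<^sup>2 \<le> ennreal ((min \<bar>s\<bar> (1 / c))\<^sup>2)"
    by (intro W2_squared_le[of _ T] \<mu>.prob_space_axioms) auto
  then show ?thesis by (simp add: W2_pdf_def \<mu>_def \<nu>_def g_def)
qed

theorem theorem4p6:
  fixes f :: "real \<Rightarrow> real" and c :: real
  assumes "c > 0"
  shows "\<exists>M>0. \<forall>D s g.
           finite_domain D \<and> g = shifted D s f \<and>
           compactly_supported_pdf D f \<and> compactly_supported_pdf D g \<longrightarrow>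
           (W2_pdf (linear_normalization D c f) (linear_normalization D c g))\<^sup>2
             \<le> ennreal (M * (if \<bar>s\<bar> \<le> 1 / c + measure lborel (supp f) then \<bar>s\<bar>\<^sup>2 else \<bar>s\<bar>))"
\<comment> \<open>The constant depends on \<open>c\<close> alone: the entry 1 serves the quadratic
  bound and \<open>1 / c\<close> the linear one.\<close>
proof (intro exI[of _ "max 1 (1 / c)"] conjI allI impI)
  show "max 1 (1 / c) > 0" by simp
next
  fix D s and g :: "real \<Rightarrow> real"
  assume *: "finite_domain D \<and> g = shifted D s f \<and>
    compactly_supported_pdf D f \<and> compactly_supported_pdf D g"
  define m where "m = min \<bar>s\<bar> (1 / c)"
  have m: "0 \<le> m" "m \<le> \<bar>s\<bar>" "m \<le> 1 / c" using assms by (auto simp: m_def)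
  have "m\<^sup>2 \<le> 1 * \<bar>s\<bar>\<^sup>2" using m power_mono[of m "\<bar>s\<bar>" 2] by simp
  also have "\<dots> \<le> max 1 (1 / c) * \<bar>s\<bar>\<^sup>2" by (intro mult_right_mono) auto
  finally have "m\<^sup>2 \<le> max 1 (1 / c) * \<bar>s\<bar>\<^sup>2" .
  \<comment> \<open>One factor \<open>m\<close> is bounded by \<open>1 / c\<close>, the other by the
    size of the shift.\<close>
  moreover have "m\<^sup>2 \<le> max 1 (1 / c) * \<bar>s\<bar>"
    unfolding power2_eq_square using m by (intro mult_mono) auto
  ultimately have "m\<^sup>2 \<le> max 1 (1 / c) *
      (if \<bar>s\<bar> \<le> 1 / c + measure lborel (supp f) then \<bar>s\<bar>\<^sup>2 else \<bar>s\<bar>)" by simp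
  moreover have "(W2_pdf (linear_normalization D c f) (linear_normalization D c g))\<^sup>2 \<le> ennreal (m\<^sup>2)"
    using W2_linear_normalization_le[OF assms, of D f s] * by (auto simp: m_def)
  ultimately show "(W2_pdf (linear_normalization D c f) (linear_normalization D c g))\<^sup>2
      \<le> ennreal (max 1 (1 / c) *
        (if \<bar>s\<bar> \<le> 1 / c + measure lborel (supp f) then \<bar>s\<bar>\<^sup>2 else \<bar>s\<bar>))"
    using ennreal_leI order_trans by blast
qed

end
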